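(* Let $a,b,c$ be indeterminates, $R=\mathbb{Z}[a,b,c]$ and $A=R[X]/(X^3-aX^2-bX-c)$, with Frobenius form $\epsilon:A\to R$ the $R$-linear map determined by $\epsilon(1)=\epsilon(X)=0$, $\epsilon(X^2)=-1$. Let $\theta$ be the theta foam values given in the context and let $[\ ,\ ]:A\times A\to A$ be the induced branch curve operation. Then $[\ ,\ ]$ is skew-symmetric, i.e. $[U,V]=-[V,U]$ for all $U,V\in A$, and satisfies the Jacobi identity $$[U,[V,W]]+[V,[W,U]]+[W,[U,V]]=0$$ for all $U,V,W\in A$.
   Context: The multiplication and unit of $A$ are those of polynomials. The comultiplication $\Delta: A\to A\otimes_R A$ is the $A$-bimodule map with $$\Delta(1)=-(1\otimes X^2+X\otimes X+X^2\otimes 1)+a(1\otimes X+X\otimes 1)+b(1\otimes 1).$$ Equivalently, $\Delta(1)=\sum_{i=0}^2 x_i\otimes y_i$, where $x_0=1$, $x_1=X$, $x_2=X^2$ and $y_0=-X^2+aX+b$, $y_1=-X+a$, $y_2=-1$ are dual bases: $\epsilon(x_iy_j)=\delta_{ij}$. The theta foam values are the $R$-trilinear form $\theta: A\times A\times A\to R$ determined on the basis $1,X,X^2$ by $$\theta(1,X,X^2)=\theta(X^2,1,X)=\theta(X,X^2,1)=1,$$ $$\theta(1,X^2,X)=\theta(X,1,X^2)=\theta(X^2,X,1)=-1,$$ and $\theta=0$ on all other triples of basis elements. The branch curve operation is the $R$-bilinear map obtained by cutting the outgoing tube of the branch circle cobordism along the dual bases: $$[u,v]=\sum_{i=0}^{2}\theta(x_i,u,v)\,y_i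 .$$ *)

theory Defs
  imports
    "HOL-Library.Poly_Mapping"
    "HOL-Computational_Algebra.Polynomial"
begin

lifting_forget poly_mapping.lifting

section \<open>The base ring of integer polynomials in three indeterminates\<close>

datatype indet = Ind_a | Ind_b | Ind_c

text \<open>Monomials are finitely supported exponent functions, and polynomials are finitely
  supported integer-valued functions on monomials, with the convolution product.\<close>

type_synonym base_ring = "(indet \<Rightarrow>\<^sub>0 nat) \<Rightarrow>\<^sub>0 int"

definition indeterminate :: "indet \<Rightarrow> base_ring" where
  "indeterminate v = Poly_Mapping.single (Poly_Mapping.single v 1) 1"

abbreviation par_a :: base_ring where "par_a \<equiv> indeterminate Ind_a"
abbreviation par_b :: base_ring where "par_b \<equiv> indeterminate Ind_b"
abbreviation par_c :: base_ring where "par_c \<equiv> indeterminate Ind_c"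


section \<open>The algebra $A = R[X]/(X^3 - aX^2 - bX - c)$\<close>

text \<open>Coefficient lists start with the constant term.\<close>

definition modulus :: "base_ring poly" where
  "modulus = [:- par_c, - par_b, - par_a, 1:]"

quotient_type alg = "base_ring poly" / "\<lambda>p q. modulus dvd p - q"
proof (intro equivpI reflpI sympI transpI)
  show "modulus dvd p - q \<Longrightarrow> modulus dvd q - p" for p q
    by (metis dvd_minus_iff minus_diff_eq)
  show "modulus dvd p - q \<Longrightarrow> modulus dvd q - r \<Longrightarrow> modulus dvd p - r" for p q r
    using dvd_add[of modulus "p - q" "q - r"] by simp
qed simp

lemma degree_modulus: "degree modulus = 3"
  by (simp add: modulus_def)

lemma modulus_dvd_imp_zero:
  assumes "modulus dvd p" "degree p < 3"
  shows "p = 0"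
proof (rule ccontr)
  assume "p \<noteq> 0"
  from assms obtain q where q: "p = modulus * q" by (elim dvdE)
  with \<open>p \<noteq> 0\<close> have "q \<noteq> 0" by auto
  have "coeff p (3 + degree q) = lead_coeff q"
    using coeff_mult_degree_sum[of modulus q] q by (simp add: degree_modulus)
       (simp add: modulus_def numeral_3_eq_3)
  with \<open>q \<noteq> 0\<close> have "degree p \<ge> 3 + degree q"
    by (intro le_degree) simp
  with assms(2) show False by simp
qed

instantiation alg :: comm_ring_1
begin

lift_definition zero_alg :: alg is 0 .
lift_definition one_alg :: alg is 1 .
lift_definition plus_alg :: "alg \<Rightarrow> alg \<Rightarrow> alg" is "(+)"
  subgoal for p p' q q'
    using dvd_add[of modulus "p - p'" "q - q'"] by (simp add: algebra_simps)
  done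
lift_definition minus_alg :: "alg \<Rightarrow> alg \<Rightarrow> alg" is "(-)"
  subgoal for p p' q q'
    using dvd_diff[of modulus "p - p'" "q - q'"] by (simp add: algebra_simps)
  done
lift_definition uminus_alg :: "alg \<Rightarrow> alg" is uminus
  by (metis dvd_minus_iff minus_diff_minus)
lift_definition times_alg :: "alg \<Rightarrow> alg \<Rightarrow> alg" is "(*)"
  subgoal for p p' q q'
    using dvd_add[OF dvd_mult2[of modulus "p - p'" q] dvd_mult[of modulus "q - q'" p']]
    by (simp add: algebra_simps)
  done

instance
proof
  show "(0::alg) \<noteq> 1"
  proof transfer
    have "degree (- 1 :: base_ring poly) < 3" by simp
    then show "\<not> modulus dvd 0 - 1"
      using modulus_dvd_imp_zero[of "- 1"] by auto
  qed
qed (transfer; simp add: algebra_simps)+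

end

lift_definition X :: alg is "[:0, 1:]" .

lift_definition scale :: "base_ring \<Rightarrow> alg \<Rightarrow> alg" is smult
  by (metis dvd_smult smult_diff_right)

interpretation alg: module scale
  by unfold_locales (transfer; simp add: smult_add_right smult_add_left)+

lemma base_module: "module ((*) :: base_ring \<Rightarrow> base_ring \<Rightarrow> base_ring)"
  by unfold_locales (simp_all add: algebra_simps)

lemma scale_mult_left: "scale r u * v = scale r (u * v)"
  by transfer simp

lemma X_cubed: "X ^ 3 = scale par_a (X ^ 2) + scale par_b X + scale par_c 1"
  unfolding numeral_2_eq_2 numeral_3_eq_3 power_Suc power_0
  by transfer (simp add: modulus_def one_pCons)


subsection \<open>Coordinates with respect to the basis $1, X, X^2$\<close>

lemma remainder_exists: "\<exists>r. degree r < 3 \<and> modulus dvd p - r"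
proof -
  obtain q r where qr: "pseudo_divmod p modulus = (q, r)" by fastforce
  have "modulus \<noteq> 0" using degree_modulus by auto
  moreover have "coeff modulus 3 = 1" by (simp add: modulus_def numeral_3_eq_3)
  ultimately have "p = modulus * q + r" "r = 0 \<or> degree r < 3"
    using pseudo_divmod[OF _ qr] by (simp_all add: degree_modulus)
  then show ?thesis by (intro exI[of _ r]) auto
qed

definition remainder :: "base_ring poly \<Rightarrow> base_ring poly" where
  "remainder p = (THE r. degree r < 3 \<and> modulus dvd p - r)"

lemma remainder_unique:
  assumes "degree r < 3" "modulus dvd p - r" "degree s < 3" "modulus dvd p - s"
  shows "r = s"
proof -
  have "modulus dvd r - s"
    using dvd_diff[OF assms(4) assms(2)] by simp
  then have "r - s = 0"
    using assms degree_diff_less[of r 3 s] by (intro modulus_dvd_imp_zero) auto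
  then show ?thesis by simp
qed

lemma remainder: "degree (remainder p) < 3" "modulus dvd p - remainder p"
  using theI'[of "\<lambda>r. degree r < 3 \<and> modulus dvd p - r"]
    remainder_exists[of p] remainder_unique[of _ p]
  unfolding remainder_def by blast+

lemma remainderI: "degree r < 3 \<Longrightarrow> modulus dvd p - r \<Longrightarrow> remainder p = r"
  using remainder remainder_unique by blast

lift_definition coord :: "nat \<Rightarrow> alg \<Rightarrow> base_ring" is "\<lambda>i p. coeff (remainder p) i"
  subgoal for i p q
    using remainder[of q] dvd_add[of modulus "p - q" "q - remainder q"]
    by (simp add: remainderI[of "remainder q" p])
  done

lemma coord_add: "coord i (u + v) = coord i u + coord i v"
proof transfer
  fix i p q
  have "modulus dvd (p + q) - (remainder p + remainder q)"
    using dvd_add[OF remainder(2)[of p] remainder(2)[of q]] by (simp add: algebra_simps)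
  then have "remainder (p + q) = remainder p + remainder q"
    by (intro remainderI degree_add_less remainder)
  then show "coeff (remainder (p + q)) i = coeff (remainder p) i + coeff (remainder q) i"
    by simp
qed

lemma coord_scale: "coord i (scale r u) = r * coord i u"
proof transfer
  fix i r p
  have "modulus dvd smult r p - smult r (remainder p)"
    using dvd_smult[OF remainder(2)[of p], of r] by (simp add: smult_diff_right)
  moreover have "degree (smult r (remainder p)) < 3"
    using remainder(1)[of p] degree_smult_le[of r "remainder p"] by linarith
  ultimately have "remainder (smult r p) = smult r (remainder p)"
    by (intro remainderI)
  then show "coeff (remainder (smult r p)) i = r * coeff (remainder p) i"
    by simp
qed

lemma coord_basis:
  "coord i 1 = (if i = 0 then 1 else 0)"
  "coord i X = (if i = 1 then 1 else 0)"
  "coord i (X ^ 2) = (if i = 2 then 1 else 0)"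
proof -
  show "coord i 1 = (if i = 0 then 1 else 0)"
    by transfer (simp add: remainderI[of 1 1] coeff_1)
  show "coord i X = (if i = 1 then 1 else 0)"
    by transfer
      (auto simp: remainderI[of "[:0, 1:]" "[:0, 1:]"] coeff_pCons split: nat.splits)
  show "coord i (X ^ 2) = (if i = 2 then 1 else 0)"
    unfolding power2_eq_square
    by transfer
      (auto simp: remainderI[of "[:0, 0, 1:]" "[:0, 0, 1:]"] coeff_pCons split: nat.splits)
qed

lemma coord_decomp: "u = scale (coord 0 u) 1 + scale (coord 1 u) X + scale (coord 2 u) (X ^ 2)"
  unfolding power2_eq_square
proof transfer
  fix p
  define r where "r = remainder p"
  have r: "degree r < 3" "modulus dvd p - r"
    using remainder[of p] by (simp_all add: r_def)
  have "smult (coeff r 0) 1 + smult (coeff r 1) [:0, 1:]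
      + smult (coeff r 2) ([:0, 1:] * [:0, 1:]) = r"
  proof (rule poly_eqI)
    fix n
    show "coeff (smult (coeff r 0) 1 + smult (coeff r 1) [:0, 1:]
        + smult (coeff r 2) ([:0, 1:] * [:0, 1:])) n = coeff r n"
    proof (cases "n < 3")
      case True
      then have "n = 0 \<or> n = 1 \<or> n = 2" by linarith
      then show ?thesis
        by (auto simp: one_pCons numeral_2_eq_2)
    next
      case False
      then obtain k where "n = Suc (Suc (Suc k))"
        by (intro that[of "n - 3"]) simp
      moreover have "coeff r n = 0" using r(1) False by (intro coeff_eq_0) simp
      ultimately show ?thesis by (simp add: one_pCons)
    qed
  qed
  with r(2) show "modulus dvd p - (smult (coeff (remainder p) 0) 1
      + smult (coeff (remainder p) 1) [:0, 1:]
      + smult (coeff (remainder p) 2) ([:0, 1:] * [:0, 1:]))"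
    by (simp only: r_def)
qed


section \<open>The Frobenius form\<close>

abbreviation linear_form :: "(alg \<Rightarrow> base_ring) \<Rightarrow> bool" where
  "linear_form \<equiv> module_hom scale (*)"

lemma linear_form_iff:
  "linear_form f \<longleftrightarrow> (\<forall>u v. f (u + v) = f u + f v) \<and> (\<forall>r u. f (scale r u) = r * f u)"
  by (auto simp: module_hom_iff alg.module_axioms base_module)

definition is_frobenius_form :: "(alg \<Rightarrow> base_ring) \<Rightarrow> bool" where
  "is_frobenius_form \<epsilon> \<longleftrightarrow> linear_form \<epsilon> \<and> \<epsilon> 1 = 0 \<and> \<epsilon> X = 0 \<and> \<epsilon> (X ^ 2) = - 1"

definition frobenius_form :: "alg \<Rightarrow> base_ring" where
  "frobenius_form = (THE \<epsilon>. is_frobenius_form \<epsilon>)"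

lemma linear_form_expand:
  assumes "linear_form f"
  shows "f u = coord 0 u * f 1 + coord 1 u * f X + coord 2 u * f (X ^ 2)"
  using assms by (subst coord_decomp[of u]) (simp add: linear_form_iff)

lemma frobenius_form_unique:
  assumes "is_frobenius_form \<epsilon>"
  shows "\<epsilon> = (\<lambda>u. - coord 2 u)"
  using assms linear_form_expand[of \<epsilon>] by (intro ext) (simp add: is_frobenius_form_def)

lemma is_frobenius_form: "is_frobenius_form frobenius_form"
proof -
  have "is_frobenius_form (\<lambda>u. - coord 2 u)"
    by (simp add: is_frobenius_form_def linear_form_iff coord_add coord_scale coord_basis)
  then show ?thesis
    unfolding frobenius_form_def by (rule theI[OF _ frobenius_form_unique])
qed

text \<open>\<open>dual_gen i\<close> is $y_i$, the basis dual to $x_i = X^i$ under the Frobenius form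
  (see \<open>dual_bases\<close> below).\<close>

definition dual_gen :: "nat \<Rightarrow> alg" where
  "dual_gen i =
    (if i = 0 then - (X ^ 2) + scale par_a X + scale par_b 1
     else if i = 1 then - X + scale par_a 1
     else - 1)"

lemma dual_bases:
  assumes "i < 3" "j < 3"
  shows "frobenius_form (X ^ i * dual_gen j) = (if i = j then 1 else 0)"
proof -
  let ?e = frobenius_form
  have lin: "linear_form ?e" and e: "?e 1 = 0" "?e X = 0" "?e (X ^ 2) = - 1"
    using is_frobenius_form by (auto simp: is_frobenius_form_def)
  have add: "?e (u + v) = ?e u + ?e v" and sc: "?e (scale r u) = r * ?e u"
    and mi: "?e (- u) = - ?e u" "?e (u - v) = ?e u - ?e v" for u v r
    using lin module_hom.neg[OF lin, of u] module_hom.diff[OF lin, of u v]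
    by (simp_all add: linear_form_iff)
  have e3: "?e (X ^ 3) = - par_a"
    by (simp add: X_cubed add sc e)
  have pw: "X * X = X ^ 2" "X * X ^ 2 = X ^ 3" "X ^ 2 * X = X ^ 3" "X ^ 2 * X ^ 2 = X ^ 4"
    by (simp_all add: numeral_eq_Suc mult_ac)
  have sr: "u * scale r v = scale r (u * v)" for u v r
    by (metis mult.commute scale_mult_left)
  have "X ^ 4 = X * X ^ 3"
    by (simp add: numeral_eq_Suc)
  also have "\<dots> = scale par_a (X ^ 3) + scale par_b (X ^ 2) + scale par_c X"
    by (simp only: X_cubed[THEN arg_cong, of "(*) X"] distrib_left sr pw mult_1_right)
  finally have e4: "?e (X ^ 4) = - par_a * par_a - par_b"
    by (simp add: add sc e e3)
  have "i = 0 \<or> i = 1 \<or> i = 2" "j = 0 \<or> j = 1 \<or> j = 2"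
    using assms by linarith+
  then show ?thesis
    by (elim disjE)
      (simp_all add: dual_gen_def distrib_left right_diff_distrib sr pw add sc mi e e3 e4)
qed


section \<open>The theta foam values and the branch curve operation\<close>

text \<open>The value on the basis triple with exponents \<open>i\<close>, \<open>j\<close>, \<open>k\<close>.\<close>

definition theta_basis :: "nat \<Rightarrow> nat \<Rightarrow> nat \<Rightarrow> base_ring" where
  "theta_basis i j k =
    (if (i, j, k) \<in> {(0, 1, 2), (2, 0, 1), (1, 2, 0)} then 1
     else if (i, j, k) \<in> {(0, 2, 1), (1, 0, 2), (2, 1, 0)} then - 1
     else 0)"

definition is_theta :: "(alg \<Rightarrow> alg \<Rightarrow> alg \<Rightarrow> base_ring) \<Rightarrow> bool" where
  "is_theta \<theta> \<longleftrightarrow>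
     (\<forall>v w. linear_form (\<lambda>u. \<theta> u v w)) \<and>
     (\<forall>u w. linear_form (\<lambda>v. \<theta> u v w)) \<and>
     (\<forall>u v. linear_form (\<lambda>w. \<theta> u v w)) \<and>
     (\<forall>i<3. \<forall>j<3. \<forall>k<3. \<theta> (X ^ i) (X ^ j) (X ^ k) = theta_basis i j k)"

definition theta :: "alg \<Rightarrow> alg \<Rightarrow> alg \<Rightarrow> base_ring" where
  "theta = (THE \<theta>. is_theta \<theta>)"

text \<open>The bracket $[u, v]$.\<close>

definition branch :: "alg \<Rightarrow> alg \<Rightarrow> alg" where
  "branch u v = (\<Sum>i<3. scale (theta (X ^ i) u v) (dual_gen i))"

lemma linear_form_expand_sum:
  assumes "linear_form f"
  shows "f u = (\<Sum>i<3. coord i u * f (X ^ i))"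
  using linear_form_expand[OF assms, of u] by (simp add: eval_nat_numeral)

lemma theta_unique:
  assumes "is_theta \<theta>"
  shows "\<theta> = (\<lambda>u v w. \<Sum>i<3. coord i u * (\<Sum>j<3. coord j v *
    (\<Sum>k<3. coord k w * theta_basis i j k)))"
proof (intro ext)
  fix u v w
  have l: "linear_form (\<lambda>u. \<theta> u v w)" "linear_form (\<lambda>v. \<theta> u v w)" "linear_form (\<lambda>w. \<theta> u v w)"
    for u v w
    using assms by (auto simp: is_theta_def)
  have "\<theta> u v w = (\<Sum>i<3. coord i u * \<theta> (X ^ i) v w)"
    by (rule linear_form_expand_sum[OF l(1)])
  also have "\<dots> = (\<Sum>i<3. coord i u * (\<Sum>j<3. coord j v * \<theta> (X ^ i) (X ^ j) w))"
    by (intro sum.cong refl arg_cong2[where f = "(*)"] linear_form_expand_sum[OF l(2)])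
  also have "\<dots> = (\<Sum>i<3. coord i u * (\<Sum>j<3. coord j v *
      (\<Sum>k<3. coord k w * \<theta> (X ^ i) (X ^ j) (X ^ k))))"
    by (intro sum.cong refl arg_cong2[where f = "(*)"] linear_form_expand_sum[OF l(3)])
  also have "\<dots> = (\<Sum>i<3. coord i u * (\<Sum>j<3. coord j v * (\<Sum>k<3. coord k w * theta_basis i j k)))"
    using assms by (intro sum.cong refl arg_cong2[where f = "(*)"]) (auto simp: is_theta_def)
  finally show "\<theta> u v w = \<dots>" .
qed

lemma is_theta: "is_theta theta"
proof -
  have pow: "coord i (X ^ j) = (if i = j then 1 else 0)" if "j < 3" for i j
  proof -
    have "j = 0 \<or> j = 1 \<or> j = 2" using that by linarith
    then show ?thesis by (auto simp: coord_basis)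
  qed
  have sel: "(\<Sum>i<3. (if i = j then 1 else 0) * f i) = f j" if "j < 3"
    for j :: nat and f :: "nat \<Rightarrow> base_ring"
    using that by (simp add: if_distrib[of "\<lambda>x. x * _"] cong: if_cong)
  let ?t = "\<lambda>u v w. \<Sum>i<3. coord i u * (\<Sum>j<3. coord j v *
    (\<Sum>k<3. coord k w * theta_basis i j k))"
  have "linear_form (\<lambda>u. ?t u v w)" "linear_form (\<lambda>v. ?t u v w)" "linear_form (\<lambda>w. ?t u v w)"
    for u v w
    unfolding linear_form_iff
    by (auto simp: coord_add coord_scale distrib_right distrib_left sum.distrib
        sum_distrib_left mult_ac)
  moreover have "?t (X ^ i) (X ^ j) (X ^ k) = theta_basis i j k"
    if "i < 3" "j < 3" "k < 3" for i j k
    using that by (simp only: pow sel)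
  ultimately have "is_theta ?t"
    unfolding is_theta_def by blast
  then show ?thesis
    unfolding theta_def by (rule theI[OF _ theta_unique])
qed

end

theory Submission
  imports Defs
begin

text \<open>In the basis \<open>1, X, X\<^sup>2\<close> the form \<open>\<theta>\<close> is the determinant, so the coefficients
  \<open>\<theta>(x\<^sub>i, u, v)\<close> of the bracket are the entries of the cross product of the coordinate vectors
  of \<open>u\<close> and \<open>v\<close>. Hence \<open>[u, v] = M (u \<times> v)\<close> with \<open>M\<close> the matrix whose columns are
  the coordinates of the dual basis \<open>y\<^sub>0, y\<^sub>1, y\<^sub>2\<close>. Skew-symmetry is that of the cross
  product, already visible in the coefficients.

  For the Jacobi identity it suffices that the cyclic sum of \<open>u \<times> M (v \<times> w)\<close> vanishes. That
  sum is trilinear and alternating in \<open>u, v, w\<close>, so it is fixed by its value on the standard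
  basis, where it is the sum of the vectors \<open>e\<^sub>i \<times> M e\<^sub>i\<close>. The entries of this vector are the
  differences \<open>M\<^sub>j\<^sub>k - M\<^sub>k\<^sub>j\<close>, and they vanish because \<open>M\<close> is symmetric: being
  the change of basis from a basis to its dual, it is the inverse of the Gram matrix of the
  symmetric form \<open>(u, v) \<mapsto> \<epsilon>(u v)\<close>. Below, the symmetry is read off from the explicit
  formulas for the \<open>y\<^sub>i\<close>.\<close>

definition cross :: "(nat \<Rightarrow> 'a::comm_ring_1) \<Rightarrow> (nat \<Rightarrow> 'a) \<Rightarrow> nat \<Rightarrow> 'a" where
  "cross x y i = x ((i + 1) mod 3) * y ((i + 2) mod 3) - x ((i + 2) mod 3) * y ((i + 1) mod 3)"

lemma cross_skew: "cross x y i = - cross y x i"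
  by (simp add: cross_def mult.commute)

lemma sum_lessThan_3: "(\<Sum>i<3. f i) = f 0 + f 1 + f (2::nat)"
  by (simp add: eval_nat_numeral)

lemma less_3_cases: "i < 3 \<Longrightarrow> i = 0 \<or> i = 1 \<or> i = (2::nat)"
  by linarith

text \<open>Without symmetry of \<open>M\<close> the entry \<open>i\<close> of this sum would be
  \<open>M k j - M j k\<close> times the determinant of \<open>x, y, z\<close>, where \<open>j\<close> and \<open>k\<close> are the
  indices following \<open>i\<close> in cyclic order.\<close>

lemma cross_symmetric_matrix_jacobi:
  fixes M :: "nat \<Rightarrow> nat \<Rightarrow> 'a::comm_ring_1"
  assumes sym: "\<And>j k. j < 3 \<Longrightarrow> k < 3 \<Longrightarrow> M j k = M k j" and "i < 3"
  defines "b \<equiv> \<lambda>x y j. \<Sum>k<3. M j k * cross x y k"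
  shows "cross x (b y z) i + cross y (b z x) i + cross z (b x y) i = 0"
proof -
  have M: "M 1 0 = M 0 1" "M 2 0 = M 0 2" "M 2 1 = M 1 2"
    by (simp_all add: sym)
  have m: "Suc 0 mod 3 = 1" "Suc (Suc 0) mod 3 = 2"
    by simp_all
  show ?thesis
    using less_3_cases[OF \<open>i < 3\<close>]
    by (elim disjE) (simp_all add: b_def cross_def sum_lessThan_3 M[simplified] m algebra_simps)
qed

lemma theta_basis_cross:
  assumes "i < 3"
  shows "theta (X ^ i) u v = cross (\<lambda>j. coord j u) (\<lambda>j. coord j v) i"
proof -
  have "coord j (X ^ i) = (if j = i then 1 else 0)" for j
    using less_3_cases[OF assms] by (auto simp: coord_basis)
  then show ?thesis
    using less_3_cases[OF assms]
    by (auto simp: theta_unique[OF is_theta] sum_lessThan_3 theta_basis_def cross_def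
        simp flip: numeral_2_eq_2)
qed

lemma coord_zero: "coord i 0 = 0"
  using coord_add[of i 0 0] by simp

lemma coord_minus: "coord i (- u) = - coord i u"
  using coord_add[of i u "- u"] by (simp add: coord_zero eq_neg_iff_add_eq_0 add.commute)

lemma coord_diff: "coord i (u - v) = coord i u - coord i v"
  using coord_add[of i u "- v"] by (simp add: coord_minus)

lemma coord_dual_gen_symmetric:
  assumes "i < 3" "j < 3"
  shows "coord i (dual_gen j) = coord j (dual_gen i)"
  using less_3_cases[OF assms(1)] less_3_cases[OF assms(2)]
  by (elim disjE) (simp_all add: dual_gen_def coord_add coord_diff coord_minus coord_scale coord_basis
      coord_basis[simplified])

lemma branch_cross:
  "branch u v = (\<Sum>i<3. scale (cross (\<lambda>j. coord j u) (\<lambda>j. coord j v) i) (dual_gen i))"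
  by (simp add: branch_def theta_basis_cross)

lemma coord_branch:
  "coord j (branch u v) =
    (\<Sum>k<3. coord j (dual_gen k) * cross (\<lambda>j. coord j u) (\<lambda>j. coord j v) k)"
  by (simp add: branch_cross sum_lessThan_3 coord_add coord_scale mult.commute)

lemma branch_skew: "branch u v = - branch v u"
  unfolding branch_cross
  by (subst cross_skew) (simp add: sum_negf)

theorem proposition3p2:
  shows "(\<forall>U V :: alg. branch U V = - branch V U) \<and>
    (\<forall>U V W :: alg.
      branch U (branch V W) + branch V (branch W U) + branch W (branch U V) = 0)"
proof (intro conjI allI)
  fix U V W :: alg
  show "branch U V = - branch V U"
    by (rule branch_skew)
  let ?c = "\<lambda>U V. cross (\<lambda>j. coord j U) (\<lambda>j. coord j V)"
  have "?c U (branch V W) i + ?c V (branch W U) i + ?c W (branch U V) i = 0" if "i < 3" for i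
    unfolding coord_branch
    by (intro cross_symmetric_matrix_jacobi coord_dual_gen_symmetric that)
  then have "(\<Sum>i<3. scale (?c U (branch V W) i + ?c V (branch W U) i + ?c W (branch U V) i)
      (dual_gen i)) = 0"
    by simp
  then show "branch U (branch V W) + branch V (branch W U) + branch W (branch U V) = 0"
    by (simp only: branch_cross[of U "branch V W"] branch_cross[of V "branch W U"]
        branch_cross[of W "branch U V"] alg.scale_left_distrib sum.distrib)
qed

end
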